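(* Let $R$ be a commutative ring with identity, let $A=R[X_1,\ldots,X_n]$ with $n\ge 1$, let $\prec$ be a rational monomial order on $A$, and let $M\in\mathbb N^{n\times n}$ be a matrix of rank $n$ representing $\prec$. Let $S=R[U_1,\ldots,U_n,X_1,\ldots,X_n]$, equipped with the lexicographic monomial order $\prec_{\mathrm{lex}}$ determined by $U_1\succ\cdots\succ U_n\succ X_1\succ\cdots\succ X_n$, and let $\Psi_M\colon A\to S$ be the $R$-algebra homomorphism with $\Psi_M(X^\alpha)=U^{M\alpha}X^\alpha$ for all $\alpha\in\mathbb N^n$. Let $I=\langle f_1,\ldots,f_s\rangle\subseteq A$, and let $H$ be the ideal of $S$ generated by $\Psi_M(f_1),\ldots,\Psi_M(f_s)$. If $\operatorname{LT}_{\prec_{\mathrm{lex}}}(H)$ is finitely generated, then $\operatorname{LT}_\prec(I)$ is finitely generated. Equivalently, if $H$ admits a finite Gröbner basis with respect to $\prec_{\mathrm{lex}}$, then $I$ admits a finite Gröbner basis with respect to $\prec$.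
   Context: $\mathbb N=\{0,1,2,\ldots\}$; $X^\alpha=X_1^{\alpha_1}\cdots X_n^{\alpha_n}$ and $U^p=U_1^{p_1}\cdots U_n^{p_n}$ for $\alpha,p\in\mathbb N^n$. Monomial order: a total order on the monomials of a polynomial ring that has $1$ as least element, is compatible with multiplication by monomials, and for which every nonempty set of monomials has a least element. For $u,v\in\mathbb R^m$, $u<_{\mathrm{lex}}v$ means that the first nonzero coordinate of $v-u$ exists and is positive. A matrix $B\in\mathbb R^{m\times n}$ represents $\prec$ if $X^\alpha\prec X^\beta\Longleftrightarrow B\alpha<_{\mathrm{lex}}B\beta$ for all $\alpha,\beta\in\mathbb N^n$. A monomial order is rational if it is represented by a finite matrix with rational entries (it is known that it is then represented by some $M\in\mathbb N^{n\times n}$ of rank $n$). The lexicographic order for $Y_1\succ\cdots\succ Y_r$ is given by $Y^a\prec_{\mathrm{lex}}Y^b$ if and only if, at the first index $i$ with $a_i\neq b_i$, one has $a_i<b_i$. Leading terms include the coefficient: $\operatorname{LT}_\prec(f)=c_{\alpha_0}X^{\alpha_0}$, where $X^{\alpha_0}$ is the largest monomial in the support of $f=\sum_\alpha c_\alpha X^\alpha\neq0$. For an ideal $J$, $\operatorname{LT}_\prec(J)=\langle\operatorname{LT}_\prec(f)\mid 0\ne f\in J\rangle$. A finite set $G\subseteq J\setminus\{0\}$ is a Gröbner basis of $J$ with respect to $\prec$ if $\operatorname{LT}_\prec(J)=\langle\operatorname{LT}_\prec(g)\mid g\in G\rangle$. The same definitions are used in $S$ with $\prec_{\mathrm{lex}}$.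 *)

theory Defs
  imports "HOL-Analysis.Analysis" "HOL-Library.Poly_Mapping"
begin

text \<open>
  The polynomial ring over \<open>'a\<close> in variables indexed by \<open>'v\<close> is \<open>('v \<Rightarrow>\<^sub>0 nat) \<Rightarrow>\<^sub>0 'a\<close>;
  a monomial is identified with its exponent vector, so \<open>0\<close> is the monomial 1 and \<open>+\<close> is the
  multiplication of monomials. The indices of \<open>X\<^sub>1, \<dots>, X\<^sub>n\<close> form a type
  \<open>'n :: {finite,linorder}\<close> with \<open>n = CARD('n)\<close>; its order is the numbering of the variables
  and of the rows of an \<open>n \<times> n\<close> matrix.

  The coefficient ring has sort \<open>{comm_ring,comm_monoid_mult}\<close>: a commutative ring with identity
  in which, unlike in \<^class>\<open>comm_ring_1\<close>, \<open>0 = 1\<close> is allowed. For this reason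
  the ideals below are not the spans of the locale \<^locale>\<open>module\<close>, which needs
  \<^class>\<open>comm_ring_1\<close>.
\<close>

type_synonym 'v monomial = "'v \<Rightarrow>\<^sub>0 nat"
type_synonym ('v, 'a) mpoly = "'v monomial \<Rightarrow>\<^sub>0 'a"


section \<open>Ideals\<close>

definition is_ideal :: "'b::comm_ring set \<Rightarrow> bool" where
  "is_ideal J \<longleftrightarrow> 0 \<in> J \<and> (\<forall>a\<in>J. \<forall>b\<in>J. a - b \<in> J) \<and> (\<forall>r. \<forall>a\<in>J. r * a \<in> J)"

definition ideal_gen :: "'b::comm_ring set \<Rightarrow> 'b set" where
  "ideal_gen B = \<Inter>{J. is_ideal J \<and> B \<subseteq> J}"

definition finitely_generated :: "'b::comm_ring set \<Rightarrow> bool" where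
  "finitely_generated J \<longleftrightarrow> (\<exists>B. finite B \<and> J = ideal_gen B)"


section \<open>Monomial orders\<close>

text \<open>A monomial order is given by its strict part.\<close>

definition monomial_order :: "('v monomial \<Rightarrow> 'v monomial \<Rightarrow> bool) \<Rightarrow> bool" where
  "monomial_order ord \<longleftrightarrow>
     irreflp ord \<and> transp ord \<and> totalp ord \<and>
     (\<forall>s. s \<noteq> 0 \<longrightarrow> ord 0 s) \<and>
     (\<forall>s t u. ord s t \<longrightarrow> ord (s + u) (t + u)) \<and>
     (\<forall>T. T \<noteq> {} \<longrightarrow> (\<exists>s\<in>T. \<forall>t\<in>T. t \<noteq> s \<longrightarrow> ord s t))"

text \<open>Lexicographic comparison of two vectors whose coordinates are indexed by \<open>K\<close>.\<close>

definition lex_less :: "'k::linorder set \<Rightarrow> ('k \<Rightarrow> 'b::linorder) \<Rightarrow> ('k \<Rightarrow> 'b) \<Rightarrow> bool" where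
  "lex_less K u v \<longleftrightarrow> (\<exists>i\<in>K. u i < v i \<and> (\<forall>j\<in>K. j < i \<longrightarrow> u j = v j))"

definition exp_vec :: "'n::finite monomial \<Rightarrow> nat ^ 'n" where
  "exp_vec \<alpha> = (\<chi> j. Poly_Mapping.lookup \<alpha> j)"

text \<open>
  A real matrix with \<open>n\<close> columns is given by the family \<open>B\<close> of its rows, indexed by the finite set
  \<open>K\<close>; this allows one to quantify over the number of rows. The \<open>i\<close>-th coordinate
  of \<open>B \<alpha>\<close> is then \<open>B i \<bullet> \<alpha>\<close>.
\<close>

definition represents ::
  "'k::linorder set \<Rightarrow> ('k \<Rightarrow> real ^ 'n::finite) \<Rightarrow> ('n monomial \<Rightarrow> 'n monomial \<Rightarrow> bool) \<Rightarrow> bool" where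
  "represents K B ord \<longleftrightarrow>
     (\<forall>\<alpha> \<beta>. ord \<alpha> \<beta> \<longleftrightarrow>
        lex_less K (\<lambda>i. B i \<bullet> (\<chi> j. real (exp_vec \<alpha> $ j)))
                   (\<lambda>i. B i \<bullet> (\<chi> j. real (exp_vec \<beta> $ j))))"

definition rational_monomial_order :: "('n::finite monomial \<Rightarrow> 'n monomial \<Rightarrow> bool) \<Rightarrow> bool" where
  "rational_monomial_order ord \<longleftrightarrow>
     monomial_order ord \<and>
     (\<exists>(m::nat) B. (\<forall>i<m. \<forall>j. B i $ j \<in> \<rat>) \<and> represents {..<m} B ord)"


section \<open>Leading terms and Groebner bases\<close>

definition leading_monomial ::
  "('v monomial \<Rightarrow> 'v monomial \<Rightarrow> bool) \<Rightarrow> ('v, 'a::zero) mpoly \<Rightarrow> 'v monomial" where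
  "leading_monomial ord f =
     (THE s. s \<in> Poly_Mapping.keys f \<and> (\<forall>t\<in>Poly_Mapping.keys f. t \<noteq> s \<longrightarrow> ord t s))"

definition leading_term ::
  "('v monomial \<Rightarrow> 'v monomial \<Rightarrow> bool) \<Rightarrow> ('v, 'a::zero) mpoly \<Rightarrow> ('v, 'a) mpoly" where
  "leading_term ord f =
     Poly_Mapping.single (leading_monomial ord f) (Poly_Mapping.lookup f (leading_monomial ord f))"

definition leading_term_ideal ::
  "('v monomial \<Rightarrow> 'v monomial \<Rightarrow> bool) \<Rightarrow> ('v, 'a::comm_ring) mpoly set \<Rightarrow> ('v, 'a) mpoly set" where
  "leading_term_ideal ord J = ideal_gen (leading_term ord ` (J - {0}))"

definition groebner_basis ::
  "('v monomial \<Rightarrow> 'v monomial \<Rightarrow> bool) \<Rightarrow> ('v, 'a::comm_ring) mpoly set \<Rightarrow>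
     ('v, 'a) mpoly set \<Rightarrow> bool" where
  "groebner_basis ord J G \<longleftrightarrow>
     finite G \<and> G \<subseteq> J - {0} \<and> leading_term_ideal ord J = ideal_gen (leading_term ord ` G)"


section \<open>The ring \<open>S = R[U, X]\<close>\<close>

datatype 'n uxvar = U 'n | X 'n

text \<open>A smaller variable is more significant: every \<open>U\<close> comes before every \<open>X\<close>.\<close>

instantiation uxvar :: (linorder) linorder
begin

fun less_uxvar :: "'a uxvar \<Rightarrow> 'a uxvar \<Rightarrow> bool" where
  "less_uxvar (U i) (U j) \<longleftrightarrow> i < j"
| "less_uxvar (U i) (X j) \<longleftrightarrow> True"
| "less_uxvar (X i) (U j) \<longleftrightarrow> False"
| "less_uxvar (X i) (X j) \<longleftrightarrow> i < j"

definition less_eq_uxvar :: "'a uxvar \<Rightarrow> 'a uxvar \<Rightarrow> bool" where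
  "less_eq_uxvar v w \<longleftrightarrow> v < w \<or> v = w"

instance
proof
  fix x y z :: "'a uxvar"
  show "x < y \<longleftrightarrow> x \<le> y \<and> \<not> y \<le> x"
    by (cases x; cases y) (auto simp: less_eq_uxvar_def)
  show "x \<le> x"
    by (simp add: less_eq_uxvar_def)
  show "x \<le> y \<Longrightarrow> y \<le> z \<Longrightarrow> x \<le> z"
    by (cases x; cases y; cases z) (auto simp: less_eq_uxvar_def)
  show "x \<le> y \<Longrightarrow> y \<le> x \<Longrightarrow> x = y"
    by (cases x; cases y) (auto simp: less_eq_uxvar_def)
  show "x \<le> y \<or> y \<le> x"
    by (cases x; cases y) (auto simp: less_eq_uxvar_def)
qed

end

text \<open>
  The lexicographic monomial order for \<open>U\<^sub>1 > \<dots> > U\<^sub>n > X\<^sub>1 > \<dots> > X\<^sub>n\<close>. It agrees with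
  the order \<open><\<close> that the library puts on finitely supported functions.
\<close>

definition lex_order :: "'v::linorder monomial \<Rightarrow> 'v monomial \<Rightarrow> bool" where
  "lex_order s t \<longleftrightarrow> lex_less UNIV (Poly_Mapping.lookup s) (Poly_Mapping.lookup t)"

lemma lex_order_eq_less: "lex_order s t \<longleftrightarrow> s < t"
  by (auto simp: lex_order_def lex_less_def less_poly_mapping.rep_eq less_fun_def)

text \<open>The exponent vector of \<open>U\<^sup>p X\<^sup>\<alpha>\<close>.\<close>

definition ux_monomial :: "nat ^ 'n::finite \<Rightarrow> 'n monomial \<Rightarrow> 'n uxvar monomial" where
  "ux_monomial p \<alpha> = Abs_poly_mapping (case_uxvar (\<lambda>i. p $ i) (Poly_Mapping.lookup \<alpha>))"

lemma lookup_ux_monomial: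
  "Poly_Mapping.lookup (ux_monomial p \<alpha>) v = (case v of U i \<Rightarrow> p $ i | X i \<Rightarrow> Poly_Mapping.lookup \<alpha> i)"
proof -
  have "(UNIV :: 'a uxvar set) = range U \<union> range X"
    by (metis UNIV_eq_I Un_iff rangeI uxvar.exhaust)
  then have "finite (UNIV :: 'a uxvar set)"
    by (metis finite_Un finite_imageI finite)
  then have "finite {v. case_uxvar (\<lambda>i. p $ i) (Poly_Mapping.lookup \<alpha>) v \<noteq> 0}"
    by (rule finite_subset[rotated]) simp
  then show ?thesis
    by (simp add: ux_monomial_def Abs_poly_mapping_inverse)
qed

text \<open>
  \<open>\<Psi>\<^sub>M\<close>, written out on \<open>\<Sum>\<^sub>\<alpha> c\<^sub>\<alpha> X\<^sup>\<alpha>\<close>. The lemmas after the definition state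
  that it is the \<open>R\<close>-algebra homomorphism with \<open>X\<^sup>\<alpha> \<mapsto> U\<^bsup>M\<alpha>\<^esup> X\<^sup>\<alpha>\<close>.
\<close>

definition Psi :: "nat ^ 'n ^ 'n \<Rightarrow> ('n::finite, 'a::comm_ring) mpoly \<Rightarrow> ('n uxvar, 'a) mpoly" where
  "Psi M f =
     (\<Sum>\<alpha>\<in>Poly_Mapping.keys f.
        Poly_Mapping.single (ux_monomial (M *v exp_vec \<alpha>) \<alpha>) (Poly_Mapping.lookup f \<alpha>))"

lemma Psi_single:
  "Psi M (Poly_Mapping.single \<alpha> c) = Poly_Mapping.single (ux_monomial (M *v exp_vec \<alpha>) \<alpha>) c"
  by (simp add: Psi_def)

lemma Psi_add: "Psi M (f + g) = Psi M f + Psi M g"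
  unfolding Psi_def by (rule setsum_keys_plus_distrib) (simp_all add: single_add)

lemma Psi_monom:
  "Psi M (Poly_Mapping.single \<alpha> (1::'a::{comm_ring,comm_monoid_mult})) =
     Poly_Mapping.single (ux_monomial (M *v exp_vec \<alpha>) \<alpha>) 1"
  by (rule Psi_single)

lemma ux_monomial_zero: "ux_monomial (M *v exp_vec 0) 0 = 0"
  by (rule poly_mapping_eqI)
    (simp add: lookup_ux_monomial matrix_vector_mult_def exp_vec_def split: uxvar.split)

lemma ux_monomial_add:
  "ux_monomial (M *v exp_vec (\<alpha> + \<beta>)) (\<alpha> + \<beta>) =
     ux_monomial (M *v exp_vec \<alpha>) \<alpha> + ux_monomial (M *v exp_vec \<beta>) \<beta>"
  by (rule poly_mapping_eqI)
    (simp add: lookup_ux_monomial lookup_add matrix_vector_mult_def exp_vec_def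
       algebra_simps sum.distrib split: uxvar.split)

lemma Psi_const: "Psi M (Poly_Mapping.single 0 c) = Poly_Mapping.single 0 c"
  by (simp add: Psi_single ux_monomial_zero)

lemma poly_mapping_add_induct:
  fixes P :: "('v \<Rightarrow>\<^sub>0 'a::comm_monoid_add) \<Rightarrow> bool"
  assumes "P 0" "\<And>k c. P (Poly_Mapping.single k c)" "\<And>f g. P f \<Longrightarrow> P g \<Longrightarrow> P (f + g)"
  shows "P f"
proof -
  have "P (\<Sum>k\<in>A. Poly_Mapping.single k (Poly_Mapping.lookup f k))" if "finite A" for A
    using that by induction (auto intro: assms)
  moreover have "f = (\<Sum>k\<in>Poly_Mapping.keys f. Poly_Mapping.single k (Poly_Mapping.lookup f k))"
    by (rule poly_mapping_eqI)
      (auto simp: lookup_sum lookup_single when_def sum.delta in_keys_iff)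
  ultimately show ?thesis
    by (metis finite_keys)
qed

lemma Psi_mult: "Psi M (f * g) = Psi M f * Psi M g"
proof (induction f rule: poly_mapping_add_induct)
  case 1
  then show ?case by (simp add: Psi_def)
next
  case (2 k c)
  show ?case
    by (induction g rule: poly_mapping_add_induct)
      (simp_all add: Psi_def[of M 0] mult_single Psi_single ux_monomial_add Psi_add distrib_left)
next
  case (3 f g')
  then show ?case by (simp add: distrib_right Psi_add)
qed

end

theory Submission
  imports Defs
begin

text \<open>
  Give the monomial \<open>U\<^sup>p X\<^sup>\<alpha>\<close> the weight \<open>p - M \<alpha> \<in> \<int>\<^sup>n\<close>. The polynomials \<open>\<Psi>\<^sub>M f\<close> are homogeneous of
  weight 0, so \<open>H\<close> is a homogeneous ideal for this grading. Within one weight a monomial is determined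
  by \<open>\<alpha>\<close>, and because \<open>M\<close> represents \<open>\<prec>\<close>, the lexicographic order, which looks at
  \<open>p\<close> first, compares \<open>U\<^sup>p X\<^sup>\<alpha>\<close> and \<open>U\<^sup>q X\<^sup>\<beta>\<close> of equal weight as \<open>\<prec>\<close> compares \<open>X\<^sup>\<alpha>\<close> and \<open>X\<^sup>\<beta>\<close>
  (\<open>lex_order_iff_ord_x_part\<close>).
  Let \<open>\<epsilon>: S \<rightarrow> A\<close> be the substitution \<open>U \<mapsto> 1\<close>. On each homogeneous component \<open>\<epsilon>\<close> is then injective
  and commutes with taking leading terms.

  For \<open>0 \<noteq> h \<in> H\<close>, the component \<open>h\<^sub>w\<close> containing the leading monomial of \<open>h\<close> has the same
  leading term as \<open>h\<close>, and \<open>\<epsilon>(h\<^sub>w) \<in> I\<close>; hence \<open>\<epsilon>(LT h) = LT(\<epsilon>(h\<^sub>w))\<close> is a leading term of \<open>I\<close>.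
  Conversely \<open>LT f = \<epsilon>(LT(\<Psi>\<^sub>M f))\<close> for \<open>0 \<noteq> f \<in> I\<close>. So \<open>\<epsilon>\<close> maps the set of leading terms of \<open>H\<close> onto the
  set of leading terms of \<open>I\<close> (\<open>set_U_one_leading_terms\<close>). As \<open>\<epsilon>\<close> is a surjective ring
  homomorphism, it carries a finite generating set of \<open>LT(H)\<close> to one of \<open>LT(I)\<close>; if the
  generators are leading terms of elements of \<open>H\<close>, their images are leading terms of elements of \<open>I\<close>.
\<close>


section \<open>Ideals\<close>

lemma subset_ideal_gen: "B \<subseteq> ideal_gen B"
  by (auto simp: ideal_gen_def)

lemma ideal_gen_least: "is_ideal J \<Longrightarrow> B \<subseteq> J \<Longrightarrow> ideal_gen B \<subseteq> J"
  by (auto simp: ideal_gen_def)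

lemma is_ideal_ideal_gen: "is_ideal (ideal_gen B)"
  by (auto simp: ideal_gen_def is_ideal_def)

lemma is_ideal_zero: "is_ideal J \<Longrightarrow> 0 \<in> J"
  by (simp add: is_ideal_def)

lemma is_ideal_diff: "is_ideal J \<Longrightarrow> a \<in> J \<Longrightarrow> b \<in> J \<Longrightarrow> a - b \<in> J"
  by (simp add: is_ideal_def)

lemma is_ideal_mult: "is_ideal J \<Longrightarrow> a \<in> J \<Longrightarrow> r * a \<in> J"
  by (simp add: is_ideal_def)

lemma is_ideal_add:
  assumes "is_ideal J" "a \<in> J" "b \<in> J"
  shows "a + b \<in> J"
proof -
  have "a - (0 - b) \<in> J"
    using assms by (blast intro: is_ideal_diff is_ideal_zero)
  then show ?thesis by simp
qed

text \<open>Surjectivity makes the image of an ideal closed under multiplication by all of the target ring.\<close>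

lemma image_ideal_gen:
  fixes \<phi> :: "'b::comm_ring \<Rightarrow> 'c::comm_ring"
  assumes add: "\<And>x y. \<phi> (x + y) = \<phi> x + \<phi> y"
    and mult: "\<And>x y. \<phi> (x * y) = \<phi> x * \<phi> y"
    and surj: "surj \<phi>"
  shows "\<phi> ` ideal_gen B = ideal_gen (\<phi> ` B)"
proof
  interpret additive \<phi> by standard (rule add)
  have "is_ideal {x. \<phi> x \<in> ideal_gen (\<phi> ` B)}"
    using is_ideal_ideal_gen[of "\<phi> ` B"] by (auto simp: is_ideal_def zero diff mult)
  then have "ideal_gen B \<subseteq> {x. \<phi> x \<in> ideal_gen (\<phi> ` B)}"
    using subset_ideal_gen[of "\<phi> ` B"] by (intro ideal_gen_least) auto
  then show "\<phi> ` ideal_gen B \<subseteq> ideal_gen (\<phi> ` B)" by auto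
  have "is_ideal (\<phi> ` ideal_gen B)"
    unfolding is_ideal_def
  proof (intro conjI ballI allI)
    show "0 \<in> \<phi> ` ideal_gen B"
      using is_ideal_zero[OF is_ideal_ideal_gen] zero by (metis image_eqI)
  next
    fix a b assume "a \<in> \<phi> ` ideal_gen B" "b \<in> \<phi> ` ideal_gen B"
    then show "a - b \<in> \<phi> ` ideal_gen B"
      using is_ideal_diff[OF is_ideal_ideal_gen] by (auto simp: diff[symmetric] intro!: imageI)
  next
    fix r a assume "a \<in> \<phi> ` ideal_gen B"
    moreover obtain r' where "r = \<phi> r'" using surj by (metis surjD)
    ultimately show "r * a \<in> \<phi> ` ideal_gen B"
      using is_ideal_mult[OF is_ideal_ideal_gen] by (auto simp: mult[symmetric] intro!: imageI)
  qed
  then show "ideal_gen (\<phi> ` B) \<subseteq> \<phi> ` ideal_gen B"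
    using subset_ideal_gen[of B] by (intro ideal_gen_least) auto
qed


section \<open>Leading monomials\<close>

lemma leading_monomial_eqI:
  assumes "irreflp ord" "transp ord"
    and "s \<in> Poly_Mapping.keys f"
    and "\<And>t. t \<in> Poly_Mapping.keys f \<Longrightarrow> t \<noteq> s \<Longrightarrow> ord t s"
  shows "leading_monomial ord f = s"
  unfolding leading_monomial_def
proof (rule the_equality)
  fix t assume t: "t \<in> Poly_Mapping.keys f \<and> (\<forall>u\<in>Poly_Mapping.keys f. u \<noteq> t \<longrightarrow> ord u t)"
  show "t = s"
  proof (rule ccontr)
    assume "t \<noteq> s"
    then have "ord t s" "ord s t" using t assms(3,4) by auto
    then show False using assms(1,2) by (meson irreflpD transpD)
  qed
qed (use assms in auto)

lemma lex_order_eq_less_fun: "lex_order = (<)"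
  by (intro ext) (rule lex_order_eq_less)

lemma leading_monomial_lex_order:
  fixes h :: "('v::linorder, 'a::zero) mpoly"
  assumes "h \<noteq> 0"
  shows "leading_monomial lex_order h \<in> Poly_Mapping.keys h"
    and "\<And>t. t \<in> Poly_Mapping.keys h \<Longrightarrow> t \<noteq> leading_monomial lex_order h \<Longrightarrow>
           lex_order t (leading_monomial lex_order h)"
proof -
  let ?s = "Max (Poly_Mapping.keys h)"
  have s: "?s \<in> Poly_Mapping.keys h"
    using assms by (intro Max_in) auto
  have max: "lex_order t ?s" if "t \<in> Poly_Mapping.keys h" "t \<noteq> ?s" for t
    using Max_ge[OF finite_keys that(1)] that(2) by (simp add: lex_order_eq_less order.strict_iff_order)
  have eq: "leading_monomial lex_order h = ?s"
    using s max by (intro leading_monomial_eqI) (simp_all add: lex_order_eq_less_fun)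
  show "leading_monomial lex_order h \<in> Poly_Mapping.keys h"
    using s eq by simp
  show "\<And>t. t \<in> Poly_Mapping.keys h \<Longrightarrow> t \<noteq> leading_monomial lex_order h \<Longrightarrow>
           lex_order t (leading_monomial lex_order h)"
    using max eq by simp
qed


section \<open>The grading of \<open>S\<close> by weights\<close>

definition x_part :: "'n uxvar monomial \<Rightarrow> 'n monomial" where
  "x_part = Poly_Mapping.map_key X"

lemma lookup_x_part: "Poly_Mapping.lookup (x_part s) i = Poly_Mapping.lookup s (X i)"
  by (simp add: x_part_def map_key.rep_eq inj_def)

lemma x_part_add: "x_part (s + t) = x_part s + x_part t"
  by (rule poly_mapping_eqI) (simp add: lookup_x_part lookup_add)

lemma x_part_ux_monomial: "x_part (ux_monomial p \<alpha>) = \<alpha>"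
  by (rule poly_mapping_eqI) (simp add: lookup_x_part lookup_ux_monomial)

definition weight :: "nat ^ 'n ^ 'n \<Rightarrow> 'n::finite uxvar monomial \<Rightarrow> 'n \<Rightarrow> int" where
  "weight M s = (\<lambda>i. int (Poly_Mapping.lookup s (U i)) - int ((M *v exp_vec (x_part s)) $ i))"

lemma weight_add: "weight M (s + t) = (\<lambda>i. weight M s i + weight M t i)"
  by (simp add: weight_def x_part_add lookup_add matrix_vector_mult_def exp_vec_def
      algebra_simps sum.distrib)

lemma weight_ux_monomial: "weight M (ux_monomial (M *v exp_vec \<alpha>) \<alpha>) = (\<lambda>i. 0)"
  by (simp add: weight_def x_part_ux_monomial lookup_ux_monomial)

lemma eq_if_weight_x_part_eq:
  assumes "weight M s = weight M t" "x_part s = x_part t"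
  shows "s = t"
proof (rule poly_mapping_eqI)
  fix v
  show "Poly_Mapping.lookup s v = Poly_Mapping.lookup t v"
  proof (cases v)
    case (U i)
    then show ?thesis
      using fun_cong[OF assms(1), of i] assms(2) by (simp add: weight_def)
  next
    case (X i)
    then show ?thesis
      using assms(2) by (simp flip: lookup_x_part)
  qed
qed

text \<open>
  If \<open>p - M \<alpha> = q - M \<beta>\<close>, then \<open>q - p = M \<beta> - M \<alpha>\<close>: the vectors \<open>p\<close> and \<open>q\<close> of exponents of the \<open>U\<close>,
  which decide the lexicographic comparison, differ exactly as \<open>M \<alpha>\<close> and \<open>M \<beta>\<close> do.
\<close>

lemma lex_order_if_ord_x_part:
  fixes M :: "nat ^ 'n::{finite,linorder} ^ 'n::{finite,linorder}"
  assumes "represents UNIV (\<lambda>i. map_matrix real M $ i) ord"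
    and w: "weight M s = weight M t"
    and "ord (x_part s) (x_part t)"
  shows "lex_order s t"
proof -
  let ?Mx = "\<lambda>s i. (M *v exp_vec (x_part s)) $ i"
  have row: "map_matrix real M $ i \<bullet> (\<chi> j. real (exp_vec \<alpha> $ j)) = real ((M *v exp_vec \<alpha>) $ i)"
    for \<alpha> :: "'n monomial" and i
    by (simp add: inner_vec_def matrix_vector_mult_def map_matrix_def)
  obtain i where i: "?Mx s i < ?Mx t i" "\<And>j. j < i \<Longrightarrow> ?Mx s j = ?Mx t j"
    using assms(1,3) by (auto simp: represents_def row lex_less_def)
  have U: "int (Poly_Mapping.lookup s (U j)) - int (?Mx s j) =
      int (Poly_Mapping.lookup t (U j)) - int (?Mx t j)" for j
    using fun_cong[OF w, of j] by (simp add: weight_def)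
  show ?thesis
    unfolding lex_order_def lex_less_def
  proof (intro bexI[of _ "U i"] conjI ballI impI)
    show "Poly_Mapping.lookup s (U i) < Poly_Mapping.lookup t (U i)"
      using U[of i] i(1) by linarith
  next
    fix v assume "v < U i"
    then obtain j where "v = U j" "j < i" by (cases v) auto
    then show "Poly_Mapping.lookup s v = Poly_Mapping.lookup t v"
      using U[of j] i(2)[of j] by simp
  qed simp
qed

lemma lex_order_iff_ord_x_part:
  fixes M :: "nat ^ 'n::{finite,linorder} ^ 'n::{finite,linorder}"
  assumes rep: "represents UNIV (\<lambda>i. map_matrix real M $ i) ord"
    and ord: "irreflp ord" "totalp ord"
    and w: "weight M s = weight M t"
  shows "lex_order s t \<longleftrightarrow> ord (x_part s) (x_part t)"
proof
  assume st: "lex_order s t"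
  then have "x_part s \<noteq> x_part t"
    using eq_if_weight_x_part_eq[OF w] by (auto simp: lex_order_eq_less)
  moreover have "\<not> ord (x_part t) (x_part s)"
    using lex_order_if_ord_x_part[OF rep w[symmetric]] st by (auto simp: lex_order_eq_less)
  ultimately show "ord (x_part s) (x_part t)"
    using ord(2) by (auto dest: totalpD)
qed (rule lex_order_if_ord_x_part[OF rep w])


section \<open>Setting \<open>U\<close> to 1 on a part of the support\<close>

text \<open>
  The substitution \<open>U \<mapsto> 1\<close> applied to those terms whose monomial satisfies \<open>P\<close>. For \<open>P\<close> always true
  this is the ring homomorphism \<open>\<epsilon>\<close>; for \<open>P\<close> the monomials of weight \<open>w\<close> it is \<open>\<epsilon>\<close> composed with the
  projection to the component of weight \<open>w\<close>. Both obey the one product rule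
  \<open>set_U_one_single_mult\<close>.
\<close>

definition set_U_one ::
  "('n uxvar monomial \<Rightarrow> bool) \<Rightarrow> ('n uxvar, 'a::comm_ring) mpoly \<Rightarrow> ('n, 'a) mpoly" where
  "set_U_one P h =
     (\<Sum>s\<in>Poly_Mapping.keys h.
        if P s then Poly_Mapping.single (x_part s) (Poly_Mapping.lookup h s) else 0)"

lemma set_U_one_single:
  "set_U_one P (Poly_Mapping.single s c) = (if P s then Poly_Mapping.single (x_part s) c else 0)"
  by (simp add: set_U_one_def)

lemma set_U_one_add: "set_U_one P (g + h) = set_U_one P g + set_U_one P h"
  unfolding set_U_one_def by (rule setsum_keys_plus_distrib) (simp_all add: single_add)

lemma set_U_one_zero: "set_U_one P 0 = 0"
  by (simp add: set_U_one_def)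

lemma set_U_one_diff: "set_U_one P (g - h) = set_U_one P g - set_U_one P h"
proof -
  interpret additive "set_U_one P" by standard (rule set_U_one_add)
  show ?thesis by (rule diff)
qed

lemma set_U_one_single_mult:
  "set_U_one P (Poly_Mapping.single s c * h) =
     Poly_Mapping.single (x_part s) c * set_U_one (\<lambda>t. P (s + t)) h"
  by (induction h rule: poly_mapping_add_induct)
    (simp_all add: set_U_one_zero set_U_one_single mult_single x_part_add set_U_one_add distrib_left)

lemma set_U_one_mult:
  "set_U_one (\<lambda>_. True) (g * h) = set_U_one (\<lambda>_. True) g * set_U_one (\<lambda>_. True) h"
  by (induction g rule: poly_mapping_add_induct)
    (simp_all add: set_U_one_zero set_U_one_single set_U_one_single_mult set_U_one_add distrib_right)

lemma set_U_one_weight_Psi: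
  "set_U_one (\<lambda>s. weight M s = w) (Psi M f) = (if w = (\<lambda>_. 0) then f else 0)"
  by (induction f rule: poly_mapping_add_induct)
    (auto simp: Psi_def[of M 0] set_U_one_zero Psi_single Psi_add set_U_one_add set_U_one_single
      weight_ux_monomial x_part_ux_monomial)

lemma set_U_one_Psi: "set_U_one (\<lambda>_. True) (Psi M f) = f"
  by (induction f rule: poly_mapping_add_induct)
    (auto simp: Psi_def[of M 0] set_U_one_zero Psi_single Psi_add set_U_one_add set_U_one_single
      x_part_ux_monomial)

lemma weight_keys_Psi:
  assumes "s \<in> Poly_Mapping.keys (Psi M f)"
  shows "weight M s = (\<lambda>_. 0)"
proof -
  have "s \<in> (\<Union>\<alpha>\<in>Poly_Mapping.keys f. Poly_Mapping.keys
      (Poly_Mapping.single (ux_monomial (M *v exp_vec \<alpha>) \<alpha>) (Poly_Mapping.lookup f \<alpha>)))"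
    using assms unfolding Psi_def by (rule subsetD[OF keys_sum])
  then show ?thesis
    by (auto simp: weight_ux_monomial split: if_splits)
qed

text \<open>Within one weight no two terms are merged by \<open>U \<mapsto> 1\<close>, so no coefficient changes.\<close>

lemma lookup_set_U_one:
  assumes P: "\<And>s. P s \<longleftrightarrow> weight M s = w" and "P t"
  shows "Poly_Mapping.lookup (set_U_one P h) (x_part t) = Poly_Mapping.lookup h t"
proof -
  have "Poly_Mapping.lookup (set_U_one P h) (x_part t) =
      (\<Sum>s\<in>Poly_Mapping.keys h. if s = t then Poly_Mapping.lookup h s else 0)"
    unfolding set_U_one_def lookup_sum
  proof (rule sum.cong)
    fix s
    have "P s \<and> x_part s = x_part t \<longleftrightarrow> s = t"
      using eq_if_weight_x_part_eq[of M s t] assms by auto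
    then show "Poly_Mapping.lookup
        (if P s then Poly_Mapping.single (x_part s) (Poly_Mapping.lookup h s) else 0) (x_part t) =
        (if s = t then Poly_Mapping.lookup h s else 0)"
      by (auto simp: lookup_single when_def)
  qed simp
  then show ?thesis
    by (simp add: in_keys_iff)
qed

lemma keys_set_U_one:
  "Poly_Mapping.keys (set_U_one P h) \<subseteq> x_part ` {s \<in> Poly_Mapping.keys h. P s}"
proof -
  have "Poly_Mapping.keys (set_U_one P h) \<subseteq> (\<Union>s\<in>Poly_Mapping.keys h. Poly_Mapping.keys
      (if P s then Poly_Mapping.single (x_part s) (Poly_Mapping.lookup h s) else 0))"
    unfolding set_U_one_def by (rule keys_sum)
  then show ?thesis
    by (auto split: if_splits)
qed


section \<open>Leading terms of \<open>H\<close> and of \<open>I\<close>\<close>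

lemma Psi_in_ideal_gen:
  fixes M :: "nat ^ 'n ^ 'n"
    and F :: "('n::finite, 'a::comm_ring) mpoly set"
  assumes "f \<in> ideal_gen F"
  shows "Psi M f \<in> ideal_gen (Psi M ` F)"
proof -
  interpret additive "Psi M :: ('n, 'a) mpoly \<Rightarrow> _" by standard (rule Psi_add)
  have "is_ideal {f. Psi M f \<in> ideal_gen (Psi M ` F)}"
    using is_ideal_ideal_gen[of "Psi M ` F"] by (auto simp: is_ideal_def zero diff Psi_mult)
  then have "ideal_gen F \<subseteq> {f. Psi M f \<in> ideal_gen (Psi M ` F)}"
    using subset_ideal_gen[of "Psi M ` F"] by (intro ideal_gen_least) auto
  then show ?thesis using assms by auto
qed

text \<open>
  Multiplication by a monomial of weight \<open>v\<close> maps the component of weight \<open>w - v\<close> to that of weight \<open>w\<close>.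
  So the polynomials all of whose components are sent into \<open>I\<close> by \<open>\<epsilon>\<close> form an ideal, and this ideal
  contains the generators of \<open>H\<close>.
\<close>

lemma set_U_one_weight_in_ideal_gen:
  fixes M :: "nat ^ 'n ^ 'n"
    and F :: "('n, 'a::{comm_ring,comm_monoid_mult}) mpoly set"
  assumes "h \<in> ideal_gen (Psi M ` F)"
  shows "set_U_one (\<lambda>s. weight M s = w) h \<in> ideal_gen F"
proof -
  let ?J = "{h. \<forall>w. set_U_one (\<lambda>s. weight M s = w) h \<in> ideal_gen F}"
  note ideal = is_ideal_ideal_gen[of F]
  have mult: "r * h \<in> ?J" if "h \<in> ?J" for r h
  proof (induction r rule: poly_mapping_add_induct)
    case 1
    then show ?case by (simp add: set_U_one_zero is_ideal_zero[OF ideal])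
  next
    case (2 s c)
    have "weight M (s + t) = w \<longleftrightarrow> weight M t = (\<lambda>i. w i - weight M s i)" for t w
      by (auto simp: weight_add fun_eq_iff algebra_simps)
    then show ?case
      using that by (auto simp: set_U_one_single_mult intro: is_ideal_mult[OF ideal])
  next
    case (3 f g)
    then show ?case by (auto simp: distrib_right set_U_one_add intro: is_ideal_add[OF ideal])
  qed
  have "is_ideal ?J"
    unfolding is_ideal_def
    using mult is_ideal_zero[OF ideal] is_ideal_diff[OF ideal]
    by (auto simp: set_U_one_zero set_U_one_diff)
  moreover have "Psi M ` F \<subseteq> ?J"
    using subset_ideal_gen[of F] is_ideal_zero[OF ideal] by (auto simp: set_U_one_weight_Psi)
  ultimately have "ideal_gen (Psi M ` F) \<subseteq> ?J"
    by (rule ideal_gen_least)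
  then show ?thesis using assms by auto
qed

text \<open>
  The component of \<open>h\<close> whose weight is that of the leading monomial of \<open>h\<close> has the same leading term
  as \<open>h\<close>, and \<open>\<epsilon>\<close> preserves the order of the monomials of this component.
\<close>

lemma leading_term_set_U_one:
  fixes M :: "nat ^ 'n::{finite,linorder} ^ 'n::{finite,linorder}"
    and h :: "('n uxvar, 'a::{comm_ring,comm_monoid_mult}) mpoly"
  assumes rep: "represents UNIV (\<lambda>i. map_matrix real M $ i) ord"
    and ord: "irreflp ord" "transp ord" "totalp ord"
    and "h \<noteq> 0"
  defines "f \<equiv> set_U_one (\<lambda>s. weight M s = weight M (leading_monomial lex_order h)) h"
  shows "f \<noteq> 0" and "leading_term ord f = set_U_one (\<lambda>_. True) (leading_term lex_order h)"
proof -
  let ?s = "leading_monomial lex_order h"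
  have s: "?s \<in> Poly_Mapping.keys h"
    using leading_monomial_lex_order(1)[OF \<open>h \<noteq> 0\<close>] .
  have lookup: "Poly_Mapping.lookup f (x_part ?s) = Poly_Mapping.lookup h ?s"
    unfolding f_def by (rule lookup_set_U_one) auto
  then have key: "x_part ?s \<in> Poly_Mapping.keys f"
    using s by (simp add: in_keys_iff)
  then show "f \<noteq> 0" by auto
  have "ord \<alpha> (x_part ?s)" if \<alpha>: "\<alpha> \<in> Poly_Mapping.keys f" "\<alpha> \<noteq> x_part ?s" for \<alpha>
  proof -
    obtain t where t: "t \<in> Poly_Mapping.keys h" "weight M t = weight M ?s" "\<alpha> = x_part t"
      using \<alpha>(1) keys_set_U_one[of "\<lambda>s. weight M s = weight M ?s" h] unfolding f_def by blast
    then have "lex_order t ?s"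
      using \<alpha>(2) leading_monomial_lex_order(2)[OF \<open>h \<noteq> 0\<close>] by blast
    then show ?thesis
      using lex_order_iff_ord_x_part[OF rep ord(1,3) t(2)] t(3) by simp
  qed
  then have "leading_monomial ord f = x_part ?s"
    using ord key by (intro leading_monomial_eqI)
  then show "leading_term ord f = set_U_one (\<lambda>_. True) (leading_term lex_order h)"
    by (simp add: leading_term_def lookup set_U_one_single)
qed

lemma set_U_one_leading_terms:
  fixes M :: "nat ^ 'n::{finite,linorder} ^ 'n::{finite,linorder}"
    and F :: "('n, 'a::{comm_ring,comm_monoid_mult}) mpoly set"
  assumes rep: "represents UNIV (\<lambda>i. map_matrix real M $ i) ord"
    and ord: "irreflp ord" "transp ord" "totalp ord"
  shows "set_U_one (\<lambda>_. True) ` leading_term lex_order ` (ideal_gen (Psi M ` F) - {0}) =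
    leading_term ord ` (ideal_gen F - {0})"
proof (intro subset_antisym subsetI)
  fix x assume "x \<in> set_U_one (\<lambda>_. True) ` leading_term lex_order ` (ideal_gen (Psi M ` F) - {0})"
  then obtain h where h: "h \<in> ideal_gen (Psi M ` F)" "h \<noteq> 0"
    and x: "x = set_U_one (\<lambda>_. True) (leading_term lex_order h)" by blast
  show "x \<in> leading_term ord ` (ideal_gen F - {0})"
    unfolding x leading_term_set_U_one(2)[OF assms h(2), symmetric]
    using leading_term_set_U_one(1)[OF assms h(2)] set_U_one_weight_in_ideal_gen[OF h(1)]
    by (intro imageI) simp
next
  fix x assume "x \<in> leading_term ord ` (ideal_gen F - {0})"
  then obtain f where f: "f \<in> ideal_gen F" "f \<noteq> 0" "x = leading_term ord f" by blast
  have "Psi M f \<noteq> 0"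
    using f(2) set_U_one_Psi[of M f] set_U_one_zero by metis
  \<comment> \<open>\<open>Psi M f\<close> is its own component of weight 0, and this component becomes \<open>f\<close> again.\<close>
  moreover from leading_monomial_lex_order(1)[OF this]
  have "weight M (leading_monomial lex_order (Psi M f)) = (\<lambda>_. 0)"
    by (rule weight_keys_Psi)
  ultimately have x: "x = set_U_one (\<lambda>_. True) (leading_term lex_order (Psi M f))"
    using leading_term_set_U_one(2)[OF assms, of "Psi M f"] f(3) set_U_one_weight_Psi[of M "\<lambda>_. 0" f]
    by simp
  show "x \<in> set_U_one (\<lambda>_. True) ` leading_term lex_order ` (ideal_gen (Psi M ` F) - {0})"
    unfolding x using \<open>Psi M f \<noteq> 0\<close> Psi_in_ideal_gen[OF f(1)] by (intro imageI) simp
qed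

theorem theorem3p5:
  fixes ord :: "'n::{finite,linorder} monomial \<Rightarrow> 'n monomial \<Rightarrow> bool"
    and M :: "nat ^ 'n::{finite,linorder} ^ 'n::{finite,linorder}"
    and fs :: "('n, 'a::{comm_ring,comm_monoid_mult}) mpoly list"
    and I :: "('n, 'a) mpoly set"
    and H :: "('n uxvar, 'a) mpoly set"
  assumes "rational_monomial_order ord"
    and "rank (map_matrix real M) = CARD('n)"
    and "represents UNIV (\<lambda>i. map_matrix real M $ i) ord"
    and "I = ideal_gen (set fs)"
    and "H = ideal_gen (set (map (Psi M) fs))"
  shows "(finitely_generated (leading_term_ideal lex_order H) \<longrightarrow>
            finitely_generated (leading_term_ideal ord I)) \<and>
         ((\<exists>G. groebner_basis lex_order H G) \<longrightarrow> (\<exists>G. groebner_basis ord I G))"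
proof -
  let ?\<epsilon> = "set_U_one (\<lambda>_. True) :: ('n uxvar, 'a) mpoly \<Rightarrow> ('n, 'a) mpoly"
  have ord: "irreflp ord" "transp ord" "totalp ord"
    using assms(1) by (simp_all add: rational_monomial_order_def monomial_order_def)
  have "surj ?\<epsilon>"
    by (rule surjI) (rule set_U_one_Psi)
  then have image_gen: "?\<epsilon> ` ideal_gen B = ideal_gen (?\<epsilon> ` B)" for B
    by (intro image_ideal_gen set_U_one_add set_U_one_mult)
  have terms: "?\<epsilon> ` leading_term lex_order ` (H - {0}) = leading_term ord ` (I - {0})"
    using set_U_one_leading_terms[OF assms(3) ord] assms(4,5) by simp
  then have ideals: "leading_term_ideal ord I = ?\<epsilon> ` leading_term_ideal lex_order H"
    by (simp add: leading_term_ideal_def image_gen)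
  show ?thesis
  proof (intro conjI impI)
    assume "finitely_generated (leading_term_ideal lex_order H)"
    then show "finitely_generated (leading_term_ideal ord I)"
      unfolding finitely_generated_def ideals by (metis image_gen finite_imageI)
  next
    assume "\<exists>G. groebner_basis lex_order H G"
    then obtain G where G: "finite G" "G \<subseteq> H - {0}"
      "leading_term_ideal lex_order H = ideal_gen (leading_term lex_order ` G)"
      by (auto simp: groebner_basis_def)
    have "?\<epsilon> ` leading_term lex_order ` G \<subseteq> leading_term ord ` (I - {0})"
      using G(2) unfolding terms[symmetric] by (intro image_mono)
    then obtain G' where "G' \<subseteq> I - {0}" "finite G'"
      "?\<epsilon> ` leading_term lex_order ` G = leading_term ord ` G'"
      using G(1) by (meson finite_imageI finite_subset_image)
    then have "groebner_basis ord I G'"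
      using G(3) by (simp add: groebner_basis_def ideals image_gen)
    then show "\<exists>G. groebner_basis ord I G" ..
  qed
qed

end
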